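(* For every $n$, $\mathcal{ODP}_n$ is a $0$-$E$-unitary inverse subsemigroup of $\mathcal{I}_n$. That is, $\mathcal{ODP}_n$ is an inverse subsemigroup of $\mathcal{I}_n$ and, writing $E'$ for the set of nonzero idempotents of $\mathcal{ODP}_n$, for all $e\in E'$ and all $s\in\mathcal{ODP}_n$, if $es\in E'$ then $s\in E'$.
   Context: For $n\ge 0$ let $X_n=\{1,2,\dots,n\}$ and let $\mathcal{I}_n$ be the symmetric inverse semigroup of all partial injective maps of $X_n$ (including the empty map, which is the zero $0$). Maps are written on the right and composed left to right: $x(\alpha\beta)=(x\alpha)\beta$. $\mathcal{DP}_n$ is the set of all $\alpha\in\mathcal{I}_n$ with $|x-y|=|x\alpha-y\alpha|$ for all $x,y\in\mathrm{Dom}\,\alpha$ (partial isometries). $\mathcal{ODP}_n$ is the set of all $\alpha\in\mathcal{DP}_n$ such that $x\le y$ implies $x\alpha\le y\alpha$ for all $x,y\in\mathrm{Dom}\,\alpha$. A semigroup $S$ with zero, with set of idempotents $E$ and $E'=E\setminus\{0\}$, is called $0$-$E$-unitary if for all $e\in E'$ and $s\in S$, $es\in E'$ implies $s\in E'$. *)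

theory Defs
  imports Main
begin

text \<open>
  Semigroups are given by a carrier set and a binary operation on the ambient type, since the
  algebraic structures available in the library are either type-wide or carry a unit.
\<close>

definition semigroup_on :: "'a set \<Rightarrow> ('a \<Rightarrow> 'a \<Rightarrow> 'a) \<Rightarrow> bool" where
  "semigroup_on S m \<longleftrightarrow> S \<noteq> {} \<and> (\<forall>x\<in>S. \<forall>y\<in>S. m x y \<in> S) \<and>
     (\<forall>x\<in>S. \<forall>y\<in>S. \<forall>z\<in>S. m (m x y) z = m x (m y z))"

definition inverse_semigroup_on :: "'a set \<Rightarrow> ('a \<Rightarrow> 'a \<Rightarrow> 'a) \<Rightarrow> bool" where
  "inverse_semigroup_on S m \<longleftrightarrow> semigroup_on S m \<and>
     (\<forall>x\<in>S. \<exists>!y. y \<in> S \<and> m (m x y) x = x \<and> m (m y x) y = y)"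

text \<open>
  By uniqueness of inverses in \<open>S\<close>, the inverse of an element of \<open>T\<close> computed in \<open>T\<close> is the one
  computed in \<open>S\<close>, so closure of \<open>T\<close> under the inversion of \<open>S\<close> is part of this definition.
\<close>

definition inverse_subsemigroup_of ::
    "'a set \<Rightarrow> 'a set \<Rightarrow> ('a \<Rightarrow> 'a \<Rightarrow> 'a) \<Rightarrow> bool" where
  "inverse_subsemigroup_of T S m \<longleftrightarrow>
     inverse_semigroup_on S m \<and> T \<subseteq> S \<and> inverse_semigroup_on T m"

definition zero_of :: "'a set \<Rightarrow> ('a \<Rightarrow> 'a \<Rightarrow> 'a) \<Rightarrow> 'a \<Rightarrow> bool" where
  "zero_of S m z \<longleftrightarrow> z \<in> S \<and> (\<forall>x\<in>S. m z x = z \<and> m x z = z)"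

definition nonzero_idempotents :: "'a set \<Rightarrow> ('a \<Rightarrow> 'a \<Rightarrow> 'a) \<Rightarrow> 'a \<Rightarrow> 'a set" where
  "nonzero_idempotents S m z = {e \<in> S. m e e = e} - {z}"

definition zero_E_unitary :: "'a set \<Rightarrow> ('a \<Rightarrow> 'a \<Rightarrow> 'a) \<Rightarrow> 'a \<Rightarrow> bool" where
  "zero_E_unitary S m z \<longleftrightarrow> semigroup_on S m \<and> zero_of S m z \<and>
     (\<forall>e\<in>nonzero_idempotents S m z. \<forall>s\<in>S.
        m e s \<in> nonzero_idempotents S m z \<longrightarrow> s \<in> nonzero_idempotents S m z)"

text \<open>
  Partial maps are of type \<open>nat \<rightharpoonup> nat\<close>; the empty map is \<open>Map.empty\<close>. Maps act on the right, so
  the product \<open>\<alpha> \<beta>\<close> applies \<open>\<alpha>\<close> first, whereas \<open>\<circ>\<^sub>m\<close> applies its second argument first.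
\<close>

definition pmult :: "(nat \<rightharpoonup> nat) \<Rightarrow> (nat \<rightharpoonup> nat) \<Rightarrow> (nat \<rightharpoonup> nat)" where
  "pmult \<alpha> \<beta> = \<beta> \<circ>\<^sub>m \<alpha>"

definition sym_inv :: "nat \<Rightarrow> (nat \<rightharpoonup> nat) set" where
  "sym_inv n = {\<alpha>. dom \<alpha> \<subseteq> {1..n} \<and> ran \<alpha> \<subseteq> {1..n} \<and> inj_on \<alpha> (dom \<alpha>)}"

definition DP :: "nat \<Rightarrow> (nat \<rightharpoonup> nat) set" where
  "DP n = {\<alpha> \<in> sym_inv n. \<forall>x\<in>dom \<alpha>. \<forall>y\<in>dom \<alpha>.
     \<bar>int x - int y\<bar> = \<bar>int (the (\<alpha> x)) - int (the (\<alpha> y))\<bar>}"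

definition ODP :: "nat \<Rightarrow> (nat \<rightharpoonup> nat) set" where
  "ODP n = {\<alpha> \<in> DP n. \<forall>x\<in>dom \<alpha>. \<forall>y\<in>dom \<alpha>. x \<le> y \<longrightarrow> the (\<alpha> x) \<le> the (\<alpha> y)}"

end

theory Submission
  imports Defs
begin

text \<open>
  An order-preserving partial isometry is a restriction of a translation: \<open>x\<alpha> - x\<close> is constant on
  the domain. If \<open>e\<close> and \<open>es\<close> are nonzero idempotents, hence partial identities, then \<open>s\<close> fixes
  some point, so its translation is trivial and \<open>s\<close> is itself a partial identity.
\<close>

lemma pmult_Some_iff:
  "pmult \<alpha> \<beta> x = Some z \<longleftrightarrow> (\<exists>y. \<alpha> x = Some y \<and> \<beta> y = Some z)"
  by (auto simp: pmult_def map_comp_Some_iff)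

text \<open>Equality of partial maps is always checked on graphs; the value \<open>None\<close> then
  needs no case of its own.\<close>

lemma map_eqI_Some: "(\<And>x y. f x = Some y \<longleftrightarrow> g x = Some y) \<Longrightarrow> f = g"
  by (metis ext not_None_eq)

lemma pmult_assoc: "pmult (pmult \<alpha> \<beta>) \<gamma> = pmult \<alpha> (pmult \<beta> \<gamma>)"
  by (rule map_eqI_Some) (auto simp: pmult_Some_iff)

text \<open>In this form the range condition is symmetric in argument and value, and injectivity
  mirrors single-valuedness, so passing to the converse map is immediate.\<close>

lemma sym_inv_iff:
  "\<alpha> \<in> sym_inv n \<longleftrightarrow>
     (\<forall>x y. \<alpha> x = Some y \<longrightarrow> x \<in> {1..n} \<and> y \<in> {1..n}) \<and>
     (\<forall>x x' y. \<alpha> x = Some y \<longrightarrow> \<alpha> x' = Some y \<longrightarrow> x = x')"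
proof -
  have "inj_on \<alpha> (dom \<alpha>) \<longleftrightarrow> (\<forall>x x' y. \<alpha> x = Some y \<longrightarrow> \<alpha> x' = Some y \<longrightarrow> x = x')"
    by (force simp: inj_on_def dom_def)
  moreover have "dom \<alpha> \<subseteq> {1..n} \<and> ran \<alpha> \<subseteq> {1..n} \<longleftrightarrow>
      (\<forall>x y. \<alpha> x = Some y \<longrightarrow> x \<in> {1..n} \<and> y \<in> {1..n})"
    unfolding dom_def ran_def by blast
  ultimately show ?thesis
    unfolding sym_inv_def by blast
qed

lemma sym_inv_inj: "\<alpha> \<in> sym_inv n \<Longrightarrow> \<alpha> x = Some y \<Longrightarrow> \<alpha> x' = Some y \<Longrightarrow> x = x'"
  by (auto simp: sym_inv_iff)

text \<open>Monotonicity fixes the sign inside the absolute values, so differences themselves are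
  preserved and the shift is constant. This linear condition is easy to carry through products and
  inverses.\<close>

lemma ODP_iff_translation:
  "\<alpha> \<in> ODP n \<longleftrightarrow> \<alpha> \<in> sym_inv n \<and>
     (\<forall>x x' y y'. \<alpha> x = Some y \<longrightarrow> \<alpha> x' = Some y' \<longrightarrow> int y - int x = int y' - int x')"
  (is "_ \<longleftrightarrow> _ \<and> ?trans")
proof (intro iffI conjI)
  assume \<alpha>: "\<alpha> \<in> ODP n"
  then show "\<alpha> \<in> sym_inv n" by (simp add: ODP_def DP_def)
  show ?trans
  proof (intro allI impI)
    fix x x' y y'
    assume xy: "\<alpha> x = Some y" "\<alpha> x' = Some y'"
    then have "x \<in> dom \<alpha>" "x' \<in> dom \<alpha>" by auto
    \<comment> \<open>Nothing orders \<open>x\<close> and \<open>x'\<close>, so monotonicity is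
      instantiated in both directions.\<close>
    with \<alpha> have "\<bar>int x - int x'\<bar> = \<bar>int (the (\<alpha> x)) - int (the (\<alpha> x'))\<bar>"
      "x \<le> x' \<longrightarrow> the (\<alpha> x) \<le> the (\<alpha> x')" "x' \<le> x \<longrightarrow> the (\<alpha> x') \<le> the (\<alpha> x)"
      unfolding ODP_def DP_def by blast+
    then show "int y - int x = int y' - int x'" using xy by simp arith
  qed
next
  assume \<alpha>: "\<alpha> \<in> sym_inv n \<and> ?trans"
  have eq: "int (the (\<alpha> x)) - int x = int (the (\<alpha> x')) - int x'"
    if "x \<in> dom \<alpha>" "x' \<in> dom \<alpha>" for x x'
  proof -
    from that obtain y y' where "\<alpha> x = Some y" "\<alpha> x' = Some y'" by blast
    moreover from this \<alpha> have "int y - int x = int y' - int x'" by blast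
    ultimately show ?thesis by simp
  qed
  have "\<bar>int x - int y\<bar> = \<bar>int (the (\<alpha> x)) - int (the (\<alpha> y))\<bar> \<and>
      (x \<le> y \<longrightarrow> the (\<alpha> x) \<le> the (\<alpha> y))"
    if "x \<in> dom \<alpha>" "y \<in> dom \<alpha>" for x y
    using eq[OF that] by linarith
  with \<alpha> show "\<alpha> \<in> ODP n" by (simp add: ODP_def DP_def)
qed

text \<open>The converse relation as a map; the description \<open>THE\<close> is determined on
  \<open>ran \<alpha>\<close> when \<open>\<alpha>\<close> is injective.\<close>

definition pinv :: "(nat \<rightharpoonup> nat) \<Rightarrow> (nat \<rightharpoonup> nat)" where
  "pinv \<alpha> y = (if y \<in> ran \<alpha> then Some (THE x. \<alpha> x = Some y) else None)"

lemma pinv_Some_iff: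
  assumes "\<alpha> \<in> sym_inv n"
  shows "pinv \<alpha> y = Some x \<longleftrightarrow> \<alpha> x = Some y"
proof -
  have the: "(THE x. \<alpha> x = Some y) = z" if "\<alpha> z = Some y" for z
    using that sym_inv_inj[OF assms] by blast
  show ?thesis
    by (auto simp: pinv_def ran_def the dest: sym_inv_inj[OF assms])
qed

lemma pmult_sym_inv: "\<alpha> \<in> sym_inv n \<Longrightarrow> \<beta> \<in> sym_inv n \<Longrightarrow> pmult \<alpha> \<beta> \<in> sym_inv n"
  unfolding sym_inv_iff pmult_Some_iff by metis

lemma pinv_sym_inv:
  assumes "\<alpha> \<in> sym_inv n"
  shows "pinv \<alpha> \<in> sym_inv n"
  using assms by (auto simp: sym_inv_iff pinv_Some_iff[OF assms])

text \<open>Identifying the semigroup inverses of \<open>\<alpha>\<close> with its converse map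
  settles existence and uniqueness together.\<close>

lemma inverse_in_sym_inv_iff:
  assumes \<alpha>: "\<alpha> \<in> sym_inv n" and \<beta>: "\<beta> \<in> sym_inv n"
  shows "pmult (pmult \<alpha> \<beta>) \<alpha> = \<alpha> \<and> pmult (pmult \<beta> \<alpha>) \<beta> = \<beta> \<longleftrightarrow> \<beta> = pinv \<alpha>"
proof
  \<comment> \<open>Stated for general \<open>\<gamma>\<close> and \<open>\<delta>\<close> because
    it is used twice with the roles exchanged: each of the two equations yields one inclusion
    between the graph of \<open>\<beta>\<close> and the converse of that of
    \<open>\<alpha>\<close>.\<close>
  have inv: "\<delta> y = Some x"
    if \<gamma>: "\<gamma> \<in> sym_inv n" and eq: "pmult (pmult \<gamma> \<delta>) \<gamma> = \<gamma>" and xy: "\<gamma> x = Some y"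
    for \<gamma> \<delta> x y
  proof -
    have "pmult (pmult \<gamma> \<delta>) \<gamma> x = Some y" using eq xy by simp
    then obtain z where "\<delta> y = Some z" "\<gamma> z = Some y"
      using xy by (auto simp: pmult_Some_iff)
    then show ?thesis using sym_inv_inj[OF \<gamma> _ xy] by blast
  qed
  assume eq: "pmult (pmult \<alpha> \<beta>) \<alpha> = \<alpha> \<and> pmult (pmult \<beta> \<alpha>) \<beta> = \<beta>"
  have "\<beta> y = Some x \<longleftrightarrow> \<alpha> x = Some y" for x y
    using inv[OF \<alpha> conjunct1[OF eq]] inv[OF \<beta> conjunct2[OF eq]] by blast
  then show "\<beta> = pinv \<alpha>"
    by (intro map_eqI_Some) (simp add: pinv_Some_iff[OF \<alpha>])
next
  assume "\<beta> = pinv \<alpha>"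
  then have iff: "\<beta> y = Some x \<longleftrightarrow> \<alpha> x = Some y" for x y
    using pinv_Some_iff[OF \<alpha>] by simp
  \<comment> \<open>Read through \<open>iff\<close>, both equivalences concern
    \<open>\<alpha>\<close> alone and follow from its single-valuedness.\<close>
  have "pmult (pmult \<alpha> \<beta>) \<alpha> x = Some y \<longleftrightarrow> \<alpha> x = Some y"
    "pmult (pmult \<beta> \<alpha>) \<beta> y = Some x \<longleftrightarrow> \<beta> y = Some x" for x y
    unfolding pmult_Some_iff iff by auto
  then show "pmult (pmult \<alpha> \<beta>) \<alpha> = \<alpha> \<and> pmult (pmult \<beta> \<alpha>) \<beta> = \<beta>"
    by (simp add: map_eqI_Some)
qed

text \<open>Serves both \<open>sym_inv n\<close> and \<open>ODP n\<close>: an inverse within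
  \<open>T\<close> is also one in \<open>sym_inv n\<close>, hence equals
  \<open>pinv \<alpha>\<close>, which lies in \<open>T\<close> by closure.\<close>

lemma inverse_semigroup_on_subset_sym_inv:
  assumes "T \<subseteq> sym_inv n" "T \<noteq> {}"
    and "\<And>\<alpha> \<beta>. \<alpha> \<in> T \<Longrightarrow> \<beta> \<in> T \<Longrightarrow> pmult \<alpha> \<beta> \<in> T"
    and "\<And>\<alpha>. \<alpha> \<in> T \<Longrightarrow> pinv \<alpha> \<in> T"
  shows "inverse_semigroup_on T pmult"
proof -
  have "\<exists>!\<beta>. \<beta> \<in> T \<and> pmult (pmult \<alpha> \<beta>) \<alpha> = \<alpha> \<and> pmult (pmult \<beta> \<alpha>) \<beta> = \<beta>"
    if "\<alpha> \<in> T" for \<alpha>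
  proof -
    have "\<alpha> \<in> sym_inv n" using that assms(1) by blast
    then have "\<beta> \<in> T \<and> pmult (pmult \<alpha> \<beta>) \<alpha> = \<alpha> \<and> pmult (pmult \<beta> \<alpha>) \<beta> = \<beta> \<longleftrightarrow> \<beta> = pinv \<alpha>"
      for \<beta>
      using inverse_in_sym_inv_iff[of \<alpha> n \<beta>] assms(1) assms(4)[OF that] by auto
    then show ?thesis by simp
  qed
  with assms(2,3) show ?thesis
    by (simp add: inverse_semigroup_on_def semigroup_on_def pmult_assoc)
qed

lemma empty_in_sym_inv: "Map.empty \<in> sym_inv n"
  by (simp add: sym_inv_iff)

lemma empty_in_ODP: "Map.empty \<in> ODP n"
  by (simp add: ODP_iff_translation empty_in_sym_inv)

lemma ODP_subset_sym_inv: "ODP n \<subseteq> sym_inv n"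
  by (auto simp: ODP_iff_translation)

text \<open>Shifts add under composition.\<close>

lemma pmult_ODP:
  assumes "\<alpha> \<in> ODP n" "\<beta> \<in> ODP n"
  shows "pmult \<alpha> \<beta> \<in> ODP n"
  unfolding ODP_iff_translation
proof (intro conjI allI impI)
  show "pmult \<alpha> \<beta> \<in> sym_inv n"
    using assms ODP_subset_sym_inv pmult_sym_inv by blast
  fix x x' z z'
  assume "pmult \<alpha> \<beta> x = Some z" "pmult \<alpha> \<beta> x' = Some z'"
  then obtain y y' where "\<alpha> x = Some y" "\<beta> y = Some z" "\<alpha> x' = Some y'" "\<beta> y' = Some z'"
    by (auto simp: pmult_Some_iff)
  with assms have "int y - int x = int y' - int x'" "int z - int y = int z' - int y'"
    unfolding ODP_iff_translation by blast+
  then show "int z - int x = int z' - int x'" by linarith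
qed

text \<open>The converse has the opposite shift.\<close>

lemma pinv_ODP:
  assumes "\<alpha> \<in> ODP n"
  shows "pinv \<alpha> \<in> ODP n"
  unfolding ODP_iff_translation
proof (intro conjI allI impI)
  have \<alpha>: "\<alpha> \<in> sym_inv n" using assms ODP_subset_sym_inv by blast
  then show "pinv \<alpha> \<in> sym_inv n" by (rule pinv_sym_inv)
  fix y y' x x'
  assume "pinv \<alpha> y = Some x" "pinv \<alpha> y' = Some x'"
  then have "int y - int x = int y' - int x'"
    using assms unfolding ODP_iff_translation pinv_Some_iff[OF \<alpha>] by blast
  then show "int x - int y = int x' - int y'" by linarith
qed

lemma inverse_semigroup_on_sym_inv: "inverse_semigroup_on (sym_inv n) pmult"
  using empty_in_sym_inv[of n] pmult_sym_inv pinv_sym_inv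
  by (intro inverse_semigroup_on_subset_sym_inv[of _ n]) blast+

lemma inverse_semigroup_on_ODP: "inverse_semigroup_on (ODP n) pmult"
  using ODP_subset_sym_inv[of n] empty_in_ODP[of n] pmult_ODP pinv_ODP
  by (intro inverse_semigroup_on_subset_sym_inv[of _ n]) blast+

text \<open>If \<open>\<alpha>\<close> is idempotent and sends \<open>x\<close> to \<open>y\<close>,
  it also sends \<open>y\<close> to \<open>y\<close>, so injectivity gives
  \<open>x = y\<close>.\<close>

lemma sym_inv_idempotent_iff:
  assumes "\<alpha> \<in> sym_inv n"
  shows "pmult \<alpha> \<alpha> = \<alpha> \<longleftrightarrow> (\<forall>x y. \<alpha> x = Some y \<longrightarrow> y = x)"
proof
  assume "pmult \<alpha> \<alpha> = \<alpha>"
  then show "\<forall>x y. \<alpha> x = Some y \<longrightarrow> y = x"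
    using sym_inv_inj[OF assms] by (metis pmult_Some_iff option.inject)
next
  assume "\<forall>x y. \<alpha> x = Some y \<longrightarrow> y = x"
  then show "pmult \<alpha> \<alpha> = \<alpha>"
    by (intro map_eqI_Some) (metis pmult_Some_iff)
qed

lemma zero_of_ODP: "zero_of (ODP n) pmult Map.empty"
  by (auto simp: zero_of_def empty_in_ODP pmult_Some_iff intro!: map_eqI_Some)

text \<open>A partial identity fixes its whole domain, so being nonzero amounts to having a fixed
  point.\<close>

lemma nonzero_idempotents_ODP_iff:
  "\<alpha> \<in> nonzero_idempotents (ODP n) pmult Map.empty \<longleftrightarrow>
     \<alpha> \<in> ODP n \<and> (\<forall>x y. \<alpha> x = Some y \<longrightarrow> y = x) \<and> (\<exists>x. \<alpha> x = Some x)"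
proof (cases "\<alpha> \<in> ODP n")
  case True
  then have "pmult \<alpha> \<alpha> = \<alpha> \<longleftrightarrow> (\<forall>x y. \<alpha> x = Some y \<longrightarrow> y = x)"
    using ODP_subset_sym_inv sym_inv_idempotent_iff by blast
  moreover have "\<alpha> \<noteq> Map.empty \<longleftrightarrow> (\<exists>x y. \<alpha> x = Some y)"
    by (auto simp: fun_eq_iff)
  ultimately show ?thesis
    by (auto simp: nonzero_idempotents_def True simp del: not_None_eq)
qed (simp add: nonzero_idempotents_def)

text \<open>A fixed point forces the constant shift to be 0.\<close>

lemma ODP_fixpoint_imp_identity:
  assumes "\<alpha> \<in> ODP n" "\<alpha> x = Some x" "\<alpha> y = Some z"
  shows "z = y"
proof -
  have "int x - int x = int z - int y"
    using assms unfolding ODP_iff_translation by blast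
  then show ?thesis by simp
qed

lemma zero_E_unitary_ODP: "zero_E_unitary (ODP n) pmult Map.empty"
  unfolding zero_E_unitary_def
proof (intro conjI ballI impI)
  show "semigroup_on (ODP n) pmult"
    using inverse_semigroup_on_ODP by (simp add: inverse_semigroup_on_def)
  show "zero_of (ODP n) pmult Map.empty" by (rule zero_of_ODP)
  fix e s
  assume e: "e \<in> nonzero_idempotents (ODP n) pmult Map.empty" and s: "s \<in> ODP n"
    and es: "pmult e s \<in> nonzero_idempotents (ODP n) pmult Map.empty"
  from es obtain x where "pmult e s x = Some x"
    unfolding nonzero_idempotents_ODP_iff by blast
  \<comment> \<open>The partial identity \<open>e\<close> leaves \<open>x\<close> in place, so it is
    \<open>s\<close> that sends \<open>x\<close> to \<open>x\<close>.\<close>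
  with e have "s x = Some x"
    unfolding nonzero_idempotents_ODP_iff pmult_Some_iff by blast
  with s show "s \<in> nonzero_idempotents (ODP n) pmult Map.empty"
    unfolding nonzero_idempotents_ODP_iff using ODP_fixpoint_imp_identity by blast
qed

theorem theorem2p4:
  fixes n :: nat
  shows "inverse_subsemigroup_of (ODP n) (sym_inv n) pmult \<and>
         zero_E_unitary (ODP n) pmult Map.empty"
  using inverse_semigroup_on_sym_inv ODP_subset_sym_inv inverse_semigroup_on_ODP
    zero_E_unitary_ODP
  by (simp add: inverse_subsemigroup_of_def)

end
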